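(* If $S_{r,x}\sim S=x_1,\dots,x_s$ with $s>1$, then $T=x_2,\dots,x_s$ is a principal (+)-admissible sequence on $(\Gamma,\sigma_{x_1}\Lambda)$. If $S_1\cdots S_r$ and $T_1\cdots T_q$ are the canonical forms of $S$ and $T$, respectively, then $\mathrm{Supp}\,T_q$ is the principal filter of $(\Gamma_0,\sigma_{x_1}\Lambda)$ generated by $x$, and we have: (a) If $x_1=x$, then $q=r-1$ and $\mathrm{Supp}\,T_i=\mathrm{Supp}\,S_i$ for $0<i<r$. (b) If $x_1\ne x$, then $q=r$, $\mathrm{Supp}\,T_i=\mathrm{Supp}\,S_i$ for $i\ne m_S(x_1)$, and $\mathrm{Supp}\,T_i=\mathrm{Supp}\,S_i\setminus\{x_1\}$ for $i=m_S(x_1)$.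
   Context: $\Gamma=(\Gamma_0,\Gamma_1)$ is a finite connected graph (multiple edges allowed) without loops and with more than one vertex. An orientation $\Lambda$ on $\Gamma$ chooses for each edge a starting point and an endpoint among its incident vertices, giving a quiver $(\Gamma,\Lambda)$; all orientations are assumed to have no oriented cycles. $\Gamma_0$ is a poset $(\Gamma_0,\Lambda)$ with $x\le y$ iff there is a path (possibly of length $0$) from $x$ to $y$. A sink is a vertex at which no arrow starts. $\sigma_x\Lambda$ is the orientation obtained by reversing all arrows incident with $x$. A finite sequence $S=x_1,\dots,x_s$ of vertices ($s\ge 0$) is (+)-admissible on $(\Gamma,\Lambda)$ if $x_1$ is a sink for $\Lambda$, $x_2$ is a sink for $\sigma_{x_1}\Lambda$, and so on. $\mathfrak S$ is the set of (+)-admissible sequences on $(\Gamma,\Lambda)$. $\sim$ is the equivalence relation on $\mathfrak S$ generated by interchanging two consecutive terms $x_i,x_{i+1}$ that are not connected by an edge of $\Gamma$. $\mathrm{Supp}\,S$ is the set of vertices occurring in $S$, and $m_S(v)$ is the number of occurrences of $v$ in $S$. Canonical form: every nonempty $S\in\mathfrak S$ satisfies $S\sim S_1\cdots S_r$ (concatenation) where each segment $S_i$ is nonempty, consists of distinct vertices, and $\mathrm{Supp}\,S_i=\mathrm{Supp}\,S_iS_{i+1}\cdots S_r$; $r$ (the size) and the segments up to equivalence are determined by $S$. A filter of $(\Gamma_0,\Lambda)$ is an up-closed subset; the principal filter generated by $x$ is $\langle x\rangle=\{y: x\le y\}$. The hull $H_\Lambda(F)$ of a filter $F$ is the smallest filter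 containing $F$ and every vertex connected by an edge to a vertex in $F$. A nonempty $S\in\mathfrak S$ with canonical form $S_1\cdots S_r$ is principal if $\mathrm{Supp}\,S_i=H_\Lambda(\mathrm{Supp}\,S_{i+1})$ for $0<i<r$ and $\mathrm{Supp}\,S_r$ is a principal filter. For $r\ge1$ and $x\in\Gamma_0$, $S_{r,x}$ denotes the (unique up to $\sim$) principal sequence on $(\Gamma,\Lambda)$ of size $r$ with $\mathrm{Supp}\,S_r=\langle x\rangle$. The same notions apply to the quiver $(\Gamma,\sigma_{x_1}\Lambda)$. *)

theory Defs
  imports "Graph_Theory.Graph_Theory"
begin

text \<open>
  A quiver \<open>(\<Gamma>, \<Lambda>)\<close> is a digraph \<open>G\<close>: the vertices of \<open>\<Gamma>\<close> are \<open>verts G\<close>, its edges are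
  \<open>arcs G\<close> (several arcs may have the same ends), and \<open>tail G\<close>, \<open>head G\<close> are the orientation
  \<open>\<Lambda>\<close>, so that an arrow \<open>e\<close> starts at \<open>tail G e\<close> and ends at \<open>head G e\<close>. The underlying graph
  \<open>\<Gamma>\<close> is \<open>G\<close> with the direction of the arcs ignored; reorienting an arc swaps its ends.
  \<open>connected G\<close> is connectedness of \<open>\<Gamma>\<close>, and \<open>u \<rightarrow>\<^sup>*\<^bsub>G\<^esub> v\<close> is the order \<open>u \<le> v\<close> of the poset
  \<open>(\<Gamma>\<^sub>0, \<Lambda>)\<close>.
\<close>

locale acyclic_quiver = fin_digraph G + loopfree_digraph G
  for G :: "('v, 'e) pre_digraph" (structure) +
  assumes connected: "connected G"
    and more_than_one_vertex: "card (verts G) > 1"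
    and no_oriented_cycle: "\<not> (\<exists>p. cycle p)"

definition adjacent :: "('v, 'e) pre_digraph \<Rightarrow> 'v \<Rightarrow> 'v \<Rightarrow> bool" where
  "adjacent G u v \<longleftrightarrow>
     (\<exists>e \<in> arcs G. (tail G e = u \<and> head G e = v) \<or> (tail G e = v \<and> head G e = u))"

definition sink :: "('v, 'e) pre_digraph \<Rightarrow> 'v \<Rightarrow> bool" where
  "sink G x \<longleftrightarrow> x \<in> verts G \<and> out_arcs G x = {}"

definition reverse_at :: "'v \<Rightarrow> ('v, 'e) pre_digraph \<Rightarrow> ('v, 'e) pre_digraph" where
  "reverse_at x G = G\<lparr>
     tail := (\<lambda>e. if tail G e = x \<or> head G e = x then head G e else tail G e),
     head := (\<lambda>e. if tail G e = x \<or> head G e = x then tail G e else head G e)\<rparr>"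

fun admissible :: "('v, 'e) pre_digraph \<Rightarrow> 'v list \<Rightarrow> bool" where
  "admissible G [] \<longleftrightarrow> True"
| "admissible G (x # xs) \<longleftrightarrow> sink G x \<and> admissible (reverse_at x G) xs"

inductive interchange :: "('v, 'e) pre_digraph \<Rightarrow> 'v list \<Rightarrow> 'v list \<Rightarrow> bool"
  for G :: "('v, 'e) pre_digraph" where
  "\<lbrakk>admissible G (U @ [a, b] @ V); admissible G (U @ [b, a] @ V); \<not> adjacent G a b\<rbrakk>
     \<Longrightarrow> interchange G (U @ [a, b] @ V) (U @ [b, a] @ V)"

text \<open>The equivalence relation on the set of (+)-admissible sequences.\<close>

definition seq_equiv :: "('v, 'e) pre_digraph \<Rightarrow> 'v list \<Rightarrow> 'v list \<Rightarrow> bool" where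
  "seq_equiv G S T \<longleftrightarrow> admissible G S \<and> admissible G T \<and> equivclp (interchange G) S T"

text \<open>
  The list \<open>Ss\<close> holds the segments; it is indexed from \<open>0\<close>, so the segment \<open>S\<^sub>i\<close> is
  \<open>Ss ! (i - 1)\<close>. The support of a sequence is its \<open>set\<close>, and the multiplicity of a vertex
  in it is given by \<open>count_list\<close>.
\<close>

definition canonical_form :: "('v, 'e) pre_digraph \<Rightarrow> 'v list \<Rightarrow> 'v list list \<Rightarrow> bool" where
  "canonical_form G S Ss \<longleftrightarrow>
     S \<noteq> [] \<and> seq_equiv G S (concat Ss) \<and>
     (\<forall>i < length Ss. Ss ! i \<noteq> [] \<and> distinct (Ss ! i) \<and>
                      set (Ss ! i) = set (concat (drop i Ss)))"

definition is_filter :: "('v, 'e) pre_digraph \<Rightarrow> 'v set \<Rightarrow> bool" where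
  "is_filter G F \<longleftrightarrow> F \<subseteq> verts G \<and> (\<forall>u \<in> F. \<forall>v. u \<rightarrow>\<^sup>*\<^bsub>G\<^esub> v \<longrightarrow> v \<in> F)"

definition principal_filter :: "('v, 'e) pre_digraph \<Rightarrow> 'v \<Rightarrow> 'v set" where
  "principal_filter G x = {y. x \<rightarrow>\<^sup>*\<^bsub>G\<^esub> y}"

definition filter_hull :: "('v, 'e) pre_digraph \<Rightarrow> 'v set \<Rightarrow> 'v set" where
  "filter_hull G F = \<Inter> {H. is_filter G H \<and> F \<subseteq> H \<and> (\<forall>u \<in> F. \<forall>v. adjacent G u v \<longrightarrow> v \<in> H)}"

definition principal_sequence :: "('v, 'e) pre_digraph \<Rightarrow> 'v list \<Rightarrow> bool" where
  "principal_sequence G S \<longleftrightarrow>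
     (\<exists>Ss. canonical_form G S Ss \<and>
           (\<forall>i. Suc i < length Ss \<longrightarrow> set (Ss ! i) = filter_hull G (set (Ss ! Suc i))) \<and>
           (\<exists>x \<in> verts G. set (last Ss) = principal_filter G x))"

text \<open>
  The sequence \<open>S\<^bsub>r,x\<^esub>\<close> is only determined up to equivalence; the predicate says that \<open>R\<close> is one
  of its representatives.
\<close>

definition is_principal_seq :: "('v, 'e) pre_digraph \<Rightarrow> nat \<Rightarrow> 'v \<Rightarrow> 'v list \<Rightarrow> bool" where
  "is_principal_seq G r x R \<longleftrightarrow>
     principal_sequence G R \<and>
     (\<exists>Rs. canonical_form G R Rs \<and> length Rs = r \<and> set (last Rs) = principal_filter G x)"

end

theory Submission
  imports Defs
begin

text \<open>
  Everything is read off from multiplicities. In an admissible sequence the two ends of an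
  arrow \<open>u \<rightarrow> v\<close> occur alternately, with \<open>v\<close> first, so the multiplicity of \<open>v\<close> exceeds that of
  \<open>u\<close> by \<open>0\<close> or \<open>1\<close> (\<open>admissible_count_arc\<close>). This has two consequences. The sets of vertices
  of multiplicity greater than \<open>i\<close>, called levels here, are filters, and they are exactly the
  supports of the segments of every canonical form (\<open>canonical_form_nth\<close>). And a vertex not
  used so far has no neighbour used twice, so first occurrences can be moved to the front,
  which produces a canonical form for every nonempty admissible sequence
  (\<open>canonical_form_exists\<close>). Being principal is therefore a condition on the levels alone: the
  lowest one is principal, and each other one is the hull of the level below it.

  Deleting the first term \<open>x\<^sub>1\<close> lowers one multiplicity by one, hence removes \<open>x\<^sub>1\<close> from the
  last level containing it and leaves the other levels alone; at the same time \<open>x\<^sub>1\<close> turns from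
  a sink into a source. It remains to compare hulls and principal filters for the two
  orientations. If \<open>x\<^sub>1\<close> lies outside a filter \<open>F\<close>, the new hull is the old one without
  \<open>x\<^sub>1\<close> (\<open>filter_hull_reverse_at_avoiding\<close>). If \<open>x\<^sub>1\<close> lies in \<open>F\<close>, the two hulls agree, and \<open>F\<close> may
  even be replaced by \<open>F - {x\<^sub>1}\<close> as long as \<open>x\<^sub>1\<close> still belongs to the new hull
  (\<open>filter_hull_reverse_at_containing\<close>). The latter happens at the level where \<open>x\<^sub>1\<close> enters:
  being a sink different from \<open>x\<close>, it enters as the end of an arrow starting in that level.
  For the lowest level, a vertex \<open>x \<noteq> x\<^sub>1\<close> generates the old filter without \<open>x\<^sub>1\<close>, while for
  \<open>x = x\<^sub>1\<close> the lowest level disappears and the next one, the old hull of \<open>{x\<^sub>1}\<close>, is the new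
  filter generated by \<open>x\<^sub>1\<close>.
\<close>

section \<open>Reversing the arrows at a vertex\<close>

lemma reverse_at_simps [simp]:
  "verts (reverse_at x G) = verts G"
  "arcs (reverse_at x G) = arcs G"
  "tail (reverse_at x G) e = (if tail G e = x \<or> head G e = x then head G e else tail G e)"
  "head (reverse_at x G) e = (if tail G e = x \<or> head G e = x then tail G e else head G e)"
  by (simp_all add: reverse_at_def)

lemma reverse_at_commute: "reverse_at x (reverse_at y G) = reverse_at y (reverse_at x G)"
  by (rule pre_digraph.equality) (auto simp: fun_eq_iff)

lemma adjacent_reverse_at [simp]: "adjacent (reverse_at x G) u v \<longleftrightarrow> adjacent G u v"
  unfolding adjacent_def by auto

lemma adjacent_commute: "adjacent G u v \<longleftrightarrow> adjacent G v u"
  unfolding adjacent_def by auto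

lemma wf_digraph_reverse_at: "wf_digraph G \<Longrightarrow> wf_digraph (reverse_at x G)"
  unfolding wf_digraph_def by auto

lemma sink_iff: "sink G x \<longleftrightarrow> x \<in> verts G \<and> (\<forall>e \<in> arcs G. tail G e \<noteq> x)"
  unfolding sink_def out_arcs_def by auto

lemma sink_reverse_at:
  assumes "a \<noteq> b" "\<not> adjacent G a b"
  shows "sink (reverse_at a G) b \<longleftrightarrow> sink G b"
  using assms unfolding sink_iff adjacent_def by auto

section \<open>Admissible sequences and their multiplicities\<close>

lemma admissible_append:
  "admissible G (U @ V) \<longleftrightarrow> admissible G U \<and> admissible (fold reverse_at U G) V"
  by (induction U arbitrary: G) auto

lemma adjacent_fold_reverse_at [simp]:
  "adjacent (fold reverse_at U G) u v \<longleftrightarrow> adjacent G u v"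
  by (induction U arbitrary: G) auto

lemma admissible_subset_verts: "admissible G S \<Longrightarrow> set S \<subseteq> verts G"
  by (induction S arbitrary: G) (force simp: sink_iff)+

text \<open>
  An arrow points to whichever of its ends is to occur next, and each occurrence of one of its
  ends turns it around; so the ends alternate, beginning with the head.
\<close>

lemma admissible_count_arc:
  assumes "admissible G S" "e \<in> arcs G"
  shows "count_list S (tail G e) \<le> count_list S (head G e)"
    and "count_list S (head G e) \<le> Suc (count_list S (tail G e))"
proof -
  have "count_list S (tail G e) \<le> count_list S (head G e) \<and>
        count_list S (head G e) \<le> Suc (count_list S (tail G e))"
    using assms
  proof (induction S arbitrary: G)
    case (Cons x S)
    have sink: "tail G e \<noteq> x" and adm: "admissible (reverse_at x G) S"
      using Cons.prems by (auto simp: sink_iff)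
    show ?case
      using Cons.IH[OF adm] Cons.prems(2) sink by (auto split: if_splits)
  qed simp
  then show "count_list S (tail G e) \<le> count_list S (head G e)"
    and "count_list S (head G e) \<le> Suc (count_list S (tail G e))" by auto
qed

lemma admissible_count_adjacent:
  assumes "admissible G S" "adjacent G u v"
  shows "count_list S u \<le> Suc (count_list S v)"
  using assms admissible_count_arc unfolding adjacent_def by (metis le_SucI)

section \<open>The equivalence of admissible sequences\<close>

lemma admissible_swap:
  assumes "admissible G (U @ [a, b] @ V)" "\<not> adjacent G a b"
  shows "admissible G (U @ [b, a] @ V)"
proof (cases "a = b")
  case False
  then show ?thesis
    using assms False
    by (auto simp: admissible_append sink_reverse_at reverse_at_commute[of a b]
        adjacent_commute[of _ b a])
qed (use assms in simp)

lemma seq_equiv_refl: "admissible G S \<Longrightarrow> seq_equiv G S S"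
  by (simp add: seq_equiv_def equivclp_def)

lemma seq_equiv_trans: "seq_equiv G S T \<Longrightarrow> seq_equiv G T U \<Longrightarrow> seq_equiv G S U"
  by (auto simp: seq_equiv_def intro: equivclp_trans)

lemma seq_equiv_swap:
  assumes "admissible G (U @ [a, b] @ V)" "\<not> adjacent G a b"
  shows "seq_equiv G (U @ [a, b] @ V) (U @ [b, a] @ V)"
  unfolding seq_equiv_def
  using assms(1) admissible_swap[OF assms] interchange.intros[OF assms(1) admissible_swap[OF assms] assms(2)]
  by (blast intro: r_into_equivclp)

lemma seq_equiv_mset:
  assumes "seq_equiv G S T"
  shows "mset S = mset T"
proof -
  have "equivclp (interchange G) S T" using assms by (simp add: seq_equiv_def)
  then show ?thesis
    by (induction rule: equivclp_induct) (auto elim!: interchange.cases)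
qed

lemma seq_equiv_count: "seq_equiv G S T \<Longrightarrow> count_list S v = count_list T v"
  using seq_equiv_mset by (metis count_mset)

lemma equivclp_map:
  assumes "equivclp r a b" "\<And>x y. r x y \<Longrightarrow> s (f x) (f y)"
  shows "equivclp s (f a) (f b)"
  using assms(1)
proof (induction rule: equivclp_induct)
  case (step y z)
  then show ?case using assms(2)
    by (meson equivclp_sym equivclp_trans r_into_equivclp)
qed (simp add: equivclp_def)

lemma seq_equiv_prepend:
  assumes "admissible G U" "seq_equiv (fold reverse_at U G) V W"
  shows "seq_equiv G (U @ V) (U @ W)"
proof -
  have "interchange G (U @ X) (U @ Y)" if "interchange (fold reverse_at U G) X Y" for X Y
    using that
  proof cases
    case (1 P a b Q)
    then show ?thesis
      using interchange.intros[of G "U @ P" a b Q] assms(1) by (simp add: admissible_append)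
  qed
  then have "equivclp (interchange G) (U @ V) (U @ W)"
    using assms(2) by (auto simp: seq_equiv_def intro: equivclp_map)
  then show ?thesis using assms by (simp add: seq_equiv_def admissible_append)
qed

lemma seq_equiv_append:
  assumes "seq_equiv G V W" "admissible G (V @ U)"
  shows "seq_equiv G (V @ U) (W @ U)"
proof -
  have swap: "interchange G (X @ U) (Y @ U) \<and> admissible G (Y @ U)"
    if "interchange G X Y \<or> interchange G Y X" "admissible G (X @ U)" for X Y
  proof -
    obtain P a b Q where XY: "X = P @ [a, b] @ Q" "Y = P @ [b, a] @ Q" "\<not> adjacent G a b"
      using \<open>interchange G X Y \<or> interchange G Y X\<close>
      by (auto elim!: interchange.cases simp: adjacent_commute)
    then show ?thesis
      using admissible_swap[of G P a b "Q @ U"] that(2)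
        interchange.intros[of G P a b "Q @ U"] by auto
  qed
  have "equivclp (interchange G) V W" using assms by (simp add: seq_equiv_def)
  then show ?thesis
  proof (induction rule: equivclp_induct)
    case base
    then show ?case using assms(2) by (rule seq_equiv_refl)
  next
    case (step Y Z)
    then have "admissible G (Y @ U)" by (simp add: seq_equiv_def)
    with swap[OF step.hyps(2)] step.IH show ?case
      by (auto simp: seq_equiv_def intro: equivclp_trans r_into_equivclp)
  qed
qed

lemma seq_equiv_move_left:
  assumes "admissible G (U @ V @ [v])" "\<forall>w \<in> set V. \<not> adjacent G w v"
  shows "seq_equiv G (U @ V @ [v]) (U @ v # V)"
  using assms
proof (induction V arbitrary: U)
  case Nil
  then show ?case by (simp add: seq_equiv_refl)
next
  case (Cons w V)
  have *: "seq_equiv G (U @ w # V @ [v]) (U @ w # v # V)"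
    using Cons.IH[of "U @ [w]"] Cons.prems by simp
  moreover have "seq_equiv G (U @ w # v # V) (U @ v # w # V)"
    using seq_equiv_swap[of G U w v V] Cons.prems * by (simp add: seq_equiv_def)
  ultimately show ?case by (auto intro: seq_equiv_trans)
qed

section \<open>Levels and canonical forms\<close>

text \<open>
  The index starts from \<open>0\<close>, as for lists of segments: \<open>level S i\<close> is the support of the
  segment at position \<open>i\<close>.
\<close>

definition level :: "'v list \<Rightarrow> nat \<Rightarrow> 'v set" where
  "level S i = {v. i < count_list S v}"

lemma level_0: "level S 0 = set S"
proof -
  have "0 < count_list S v \<longleftrightarrow> v \<in> set S" for v
    by (metis count_list_0_iff gr0I less_irrefl)
  then show ?thesis by (simp add: level_def)
qed

lemma level_antimono: "i \<le> j \<Longrightarrow> level S j \<subseteq> level S i"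
  by (auto simp: level_def)

lemma seq_equiv_level: "seq_equiv G S T \<Longrightarrow> level S i = level T i"
  by (simp add: level_def seq_equiv_count)

text \<open>
  The supports of the segments decrease and every segment is free of repetitions, so a vertex of
  multiplicity \<open>m\<close> occurs in exactly the first \<open>m\<close> segments.
\<close>

lemma segments_level:
  assumes "\<forall>i < length Ss. distinct (Ss ! i) \<and> set (Ss ! i) = set (concat (drop i Ss))"
  shows "(if i < length Ss then set (Ss ! i) else {}) = level (concat Ss) i"
  using assms
proof (induction Ss arbitrary: i)
  case (Cons A Ss)
  have IH: "(if i < length Ss then set (Ss ! i) else {}) = level (concat Ss) i" for i
  proof (rule Cons.IH, intro allI impI)
    fix j assume "j < length Ss"
    then show "distinct (Ss ! j) \<and> set (Ss ! j) = set (concat (drop j Ss))"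
      using Cons.prems[rule_format, of "Suc j"] by simp
  qed
  have A: "distinct A" "set (concat Ss) \<subseteq> set A"
    using Cons.prems[rule_format, of 0] by auto
  have count: "count_list (A @ concat Ss) v =
      (if v \<in> set A then Suc (count_list (concat Ss) v) else 0)" for v
    using A distinct_count_atmost_1[of A] by (auto simp: count_mset count_list_0_iff)
  show ?case
  proof (cases i)
    case 0
    then show ?thesis using count by (auto simp: level_def split: if_splits)
  next
    case (Suc j)
    have "level (concat Ss) j \<subseteq> set A"
      using A(2) level_antimono[of 0 j "concat Ss"] by (auto simp: level_0)
    then have "level (concat (A # Ss)) (Suc j) = level (concat Ss) j"
      using count by (auto simp: level_def split: if_splits)
    then show ?thesis using IH[of j] Suc by (cases "j < length Ss") simp_all
  qed
qed (simp add: level_def)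

lemma canonical_form_level:
  assumes "canonical_form G S Ss"
  shows "(if i < length Ss then set (Ss ! i) else {}) = level S i"
  using assms segments_level[of Ss i] seq_equiv_level[of G S "concat Ss" i]
  unfolding canonical_form_def by auto

lemma canonical_form_nth:
  "canonical_form G S Ss \<Longrightarrow> i < length Ss \<Longrightarrow> set (Ss ! i) = level S i"
  using canonical_form_level[of G S Ss i] by simp

lemma canonical_form_length_iff:
  "canonical_form G S Ss \<Longrightarrow> i < length Ss \<longleftrightarrow> level S i \<noteq> {}"
  using canonical_form_level[of G S Ss i] unfolding canonical_form_def
  by (metis set_empty)

lemma canonical_form_length:
  assumes "canonical_form G S Ss" "0 < r" "level S (r - 1) \<noteq> {}" "level S r = {}"
  shows "length Ss = r"
  using canonical_form_length_iff[OF assms(1), of r] canonical_form_length_iff[OF assms(1), of "r - 1"]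
    assms(2-4) by auto

lemma canonical_form_last:
  assumes "canonical_form G S Ss"
  shows "set (last Ss) = level S (length Ss - 1)"
proof -
  have "Ss \<noteq> []"
    using canonical_form_length_iff[OF assms, of 0] assms
    by (auto simp: level_0 canonical_form_def)
  then show ?thesis
    using canonical_form_nth[OF assms, of "length Ss - 1"] by (simp add: last_conv_nth)
qed

text \<open>
  A vertex appended to a sequence moves past the repeated terms when it is new, because a vertex
  occurring twice has no neighbour that has not occurred yet.
\<close>

lemma first_occurrences_to_front:
  assumes "admissible G S"
  shows "\<exists>A B. seq_equiv G S (A @ B) \<and> distinct A \<and> set A = set S"
  using assms
proof (induction S rule: rev_induct)
  case Nil
  then show ?case by (intro exI[of _ "[]"]) (simp add: seq_equiv_refl)
next
  case (snoc v S)
  then obtain A B where AB: "seq_equiv G S (A @ B)" "distinct A" "set A = set S"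
    by (auto simp: admissible_append)
  have setAB: "set (A @ B) = set S"
    using seq_equiv_mset[OF AB(1)] by (metis set_mset_mset)
  have eq: "seq_equiv G (S @ [v]) (A @ B @ [v])"
    using seq_equiv_append[OF AB(1) snoc.prems] by simp
  show ?case
  proof (cases "v \<in> set A")
    case True
    then show ?thesis using eq AB by (intro exI[of _ A] exI[of _ "B @ [v]"]) auto
  next
    case False
    have "\<not> adjacent G w v" if "w \<in> set B" for w
    proof
      assume "adjacent G w v"
      have "w \<in> set A" using that setAB AB(3) by auto
      then have "count_list A w > 0" "count_list B w > 0"
        using that by (simp_all add: count_list_0_iff zero_less_iff_neq_zero)
      moreover have "count_list (A @ B) v = 0"
        using False setAB AB(3) by (simp only: count_list_0_iff) simp
      ultimately show False
        using admissible_count_adjacent[of G "A @ B" w v] \<open>adjacent G w v\<close> AB(1)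
        by (simp add: seq_equiv_def)
    qed
    then have "seq_equiv G (A @ B @ [v]) (A @ v # B)"
      using eq by (intro seq_equiv_move_left) (auto simp: seq_equiv_def)
    then have "seq_equiv G (S @ [v]) ((A @ [v]) @ B)"
      using eq by (auto intro: seq_equiv_trans)
    then show ?thesis using AB False
      by (intro exI[of _ "A @ [v]"] exI[of _ B]) auto
  qed
qed

lemma canonical_form_exists:
  assumes "admissible G S" "S \<noteq> []"
  shows "\<exists>Ss. canonical_form G S Ss"
  using assms
proof (induction S arbitrary: G rule: length_induct)
  case (1 S)
  obtain A B where AB: "seq_equiv G S (A @ B)" "distinct A" "set A = set S"
    using first_occurrences_to_front 1(2) by blast
  have mset: "mset S = mset (A @ B)" using AB(1) by (rule seq_equiv_mset)
  have sub: "set B \<subseteq> set A"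
    using mset AB(3) by (metis set_mset_mset set_append Un_upper2)
  have "A \<noteq> []" using AB(3) 1(3) by auto
  show ?case
  proof (cases "B = []")
    case True
    then show ?thesis using AB 1(3) \<open>A \<noteq> []\<close>
      by (intro exI[of _ "[A]"]) (auto simp: canonical_form_def)
  next
    case False
    have adm: "admissible G A" "admissible (fold reverse_at A G) B"
      using AB(1) by (auto simp: seq_equiv_def admissible_append)
    have "length B < length S"
      using mset_eq_length[OF mset] \<open>A \<noteq> []\<close> by simp
    then obtain Bs where Bs: "canonical_form (fold reverse_at A G) B Bs"
      using 1(1) adm(2) False by blast
    then have eqB: "seq_equiv (fold reverse_at A G) B (concat Bs)"
      by (simp add: canonical_form_def)
    have "set (concat Bs) = set B"
      using seq_equiv_mset[OF eqB] by (metis set_mset_mset)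
    moreover have "seq_equiv G S (A @ concat Bs)"
      using AB(1) seq_equiv_prepend[OF adm(1) eqB] by (rule seq_equiv_trans)
    ultimately have "canonical_form G S (A # Bs)"
      using Bs 1(3) \<open>A \<noteq> []\<close> AB(2) sub
      unfolding canonical_form_def by (auto simp: nth_Cons' less_Suc_eq_0_disj)
    then show ?thesis by blast
  qed
qed

section \<open>Filters, hulls and principal filters\<close>

lemma is_filter_iff:
  assumes "wf_digraph G"
  shows "is_filter G F \<longleftrightarrow>
    F \<subseteq> verts G \<and> (\<forall>e \<in> arcs G. tail G e \<in> F \<longrightarrow> head G e \<in> F)"
proof -
  interpret wf_digraph G by fact
  have "v \<in> F"
    if "\<forall>e \<in> arcs G. tail G e \<in> F \<longrightarrow> head G e \<in> F" "u \<in> F" "u \<rightarrow>\<^sup>*\<^bsub>G\<^esub> v" for u v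
    using that(3,2,1) unfolding reachable_def
    by (induction rule: rtrancl_on_induct) (auto simp: arcs_ends_conv)
  moreover have "head G e \<in> F" if "is_filter G F" "e \<in> arcs G" "tail G e \<in> F" for e
    using that in_arcs_imp_in_arcs_ends[of e] reachable_adjI unfolding is_filter_def by blast
  ultimately show ?thesis unfolding is_filter_def by blast
qed

lemma is_filter_filter_hull:
  assumes "wf_digraph G" "F \<subseteq> verts G"
  shows "is_filter G (filter_hull G F)"
proof -
  interpret wf_digraph G by fact
  have "is_filter G (verts G) \<and> F \<subseteq> verts G \<and> (\<forall>u \<in> F. \<forall>v. adjacent G u v \<longrightarrow> v \<in> verts G)"
    using assms by (auto simp: is_filter_iff adjacent_def)
  then have "filter_hull G F \<subseteq> verts G" unfolding filter_hull_def by blast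
  then show ?thesis unfolding is_filter_def filter_hull_def by blast
qed

lemma subset_filter_hull: "F \<subseteq> filter_hull G F"
  unfolding filter_hull_def by blast

lemma adjacent_in_filter_hull: "u \<in> F \<Longrightarrow> adjacent G u v \<Longrightarrow> v \<in> filter_hull G F"
  unfolding filter_hull_def by blast

lemma filter_hull_least:
  assumes "is_filter G H" "F \<subseteq> H" "\<And>u v. u \<in> F \<Longrightarrow> adjacent G u v \<Longrightarrow> v \<in> H"
  shows "filter_hull G F \<subseteq> H"
  using assms unfolding filter_hull_def by blast

lemma is_filter_principal_filter:
  assumes "wf_digraph G"
  shows "is_filter G (principal_filter G x)"
proof -
  interpret wf_digraph G by fact
  show ?thesis
    unfolding is_filter_def principal_filter_def
    by (auto intro: reachable_trans dest: reachable_in_verts)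
qed

lemma in_principal_filter: "wf_digraph G \<Longrightarrow> x \<in> verts G \<Longrightarrow> x \<in> principal_filter G x"
  by (simp add: principal_filter_def wf_digraph.reachable_refl)

lemma principal_filter_least: "is_filter G H \<Longrightarrow> x \<in> H \<Longrightarrow> principal_filter G x \<subseteq> H"
  unfolding is_filter_def principal_filter_def by blast

text \<open>
  A vertex that no arrow enters from inside can be removed from a filter. So a vertex of a
  filter that is minimal under some condition is either required by that condition or the end of
  an arrow from inside.
\<close>

lemma is_filter_remove:
  assumes "wf_digraph G" "is_filter G H"
    and "\<And>e. e \<in> arcs G \<Longrightarrow> tail G e \<in> H \<Longrightarrow> tail G e \<noteq> s \<Longrightarrow> head G e \<noteq> s"
  shows "is_filter G (H - {s})"
  using assms by (auto simp: is_filter_iff)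

lemma in_principal_filter_arc:
  assumes "wf_digraph G" "x \<in> verts G" "s \<in> principal_filter G x" "s \<noteq> x"
  shows "\<exists>e \<in> arcs G. head G e = s \<and> tail G e \<in> principal_filter G x"
  using is_filter_remove[OF assms(1) is_filter_principal_filter[OF assms(1)], of x s]
    principal_filter_least[of G "principal_filter G x - {s}" x]
    in_principal_filter[OF assms(1,2)] assms(3,4) by blast

lemma sink_in_filter_hull_arc:
  assumes "wf_digraph G" "sink G s" "is_filter G F" "s \<in> filter_hull G F" "s \<notin> F"
  shows "\<exists>e \<in> arcs G. head G e = s \<and> tail G e \<in> filter_hull G F"
proof (rule ccontr)
  assume no_arc: "\<not> ?thesis"
  have F: "F \<subseteq> verts G" using assms(3) by (simp add: is_filter_def)
  have "\<not> adjacent G u s" if "u \<in> F" for u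
    using that assms(1-3,5) by (auto simp: adjacent_def sink_iff is_filter_iff)
  then have "filter_hull G F \<subseteq> filter_hull G F - {s}"
    using no_arc assms(5) subset_filter_hull[of F G] adjacent_in_filter_hull[of _ F G]
    by (intro filter_hull_least is_filter_remove[OF assms(1) is_filter_filter_hull[OF assms(1) F]])
      blast+
  then show False using assms(4) by blast
qed

section \<open>Hulls and principal filters after reversing a sink\<close>

context
  fixes G :: "('v, 'e) pre_digraph" and s :: 'v
  assumes wf: "wf_digraph G" and sink: "sink G s"
begin

lemma is_filter_reverse_at:
  "is_filter (reverse_at s G) F \<longleftrightarrow>
     F \<subseteq> verts G \<and>
     (\<forall>e \<in> arcs G. head G e \<noteq> s \<longrightarrow> tail G e \<in> F \<longrightarrow> head G e \<in> F) \<and>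
     (\<forall>e \<in> arcs G. head G e = s \<longrightarrow> s \<in> F \<longrightarrow> tail G e \<in> F)"
  using sink by (auto simp: is_filter_iff[OF wf_digraph_reverse_at[OF wf]] sink_iff)

text \<open>
  Each of the two hulls contains \<open>s\<close> and all its neighbours, hence both ends of every reversed
  arrow; so it is a filter for either orientation.
\<close>

lemma filter_hull_reverse_at_containing:
  assumes F: "F \<subseteq> verts G" "s \<in> F" "F - {s} \<subseteq> F'" "F' \<subseteq> F"
    and s: "s \<in> filter_hull (reverse_at s G) F'"
  shows "filter_hull (reverse_at s G) F' = filter_hull G F"
proof
  let ?H = "filter_hull G F" and ?H' = "filter_hull (reverse_at s G) F'"
  have "is_filter G ?H" by (rule is_filter_filter_hull[OF wf F(1)])
  moreover have nbr: "tail G e \<in> ?H" if "e \<in> arcs G" "head G e = s" for e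
    using adjacent_in_filter_hull[of s F G "tail G e"] F(2) that by (auto simp: adjacent_def)
  ultimately have "is_filter (reverse_at s G) ?H"
    by (auto simp: is_filter_reverse_at is_filter_iff[OF wf])
  then show "?H' \<subseteq> ?H"
    using F(4) subset_filter_hull[of F G] adjacent_in_filter_hull[of _ F G]
    by (intro filter_hull_least) auto
  have F': "F' \<subseteq> verts (reverse_at s G)" using F by auto
  have filter': "is_filter (reverse_at s G) ?H'"
    by (rule is_filter_filter_hull[OF wf_digraph_reverse_at[OF wf] F'])
  then have "is_filter G ?H'"
    using s by (auto simp: is_filter_reverse_at is_filter_iff[OF wf])
  moreover have "F \<subseteq> ?H'"
    using F(3) s subset_filter_hull[of F' "reverse_at s G"] by blast
  moreover have "v \<in> ?H'" if "u \<in> F" "adjacent G u v" for u v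
  proof (cases "u = s")
    case True
    \<comment> \<open>All arrows at \<open>s\<close> now start at \<open>s\<close>, so a filter containing \<open>s\<close> contains its neighbours.\<close>
    with that(2) filter' s sink show ?thesis
      by (auto simp: is_filter_reverse_at adjacent_def sink_iff)
  next
    case False
    with that F(3) show ?thesis
      by (intro adjacent_in_filter_hull[of u]) auto
  qed
  ultimately show "?H \<subseteq> ?H'" by (rule filter_hull_least)
qed

text \<open>
  Since \<open>F\<close> is a filter without the sink \<open>s\<close>, no neighbour of \<open>s\<close> lies in \<open>F\<close>; so \<open>s\<close> enters the
  old hull at most as the end of an arrow, and it is not in the new one, for which it is a source.
\<close>

lemma filter_hull_reverse_at_avoiding:
  assumes F: "is_filter G F" "s \<notin> F"
  shows "filter_hull (reverse_at s G) F = filter_hull G F - {s}"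
proof
  let ?H = "filter_hull G F" and ?H' = "filter_hull (reverse_at s G) F"
  have verts: "F \<subseteq> verts G" "F \<subseteq> verts (reverse_at s G)" using F(1) by (auto simp: is_filter_def)
  have not_adj: "\<not> adjacent G u s" if "u \<in> F" for u
    using that F sink by (auto simp: adjacent_def sink_iff is_filter_iff[OF wf])
  have "is_filter G ?H" by (rule is_filter_filter_hull[OF wf verts(1)])
  then have "is_filter (reverse_at s G) (?H - {s})"
    by (auto simp: is_filter_reverse_at is_filter_iff[OF wf])
  then show "?H' \<subseteq> ?H - {s}"
    using F(2) subset_filter_hull[of F G] adjacent_in_filter_hull[of _ F G] not_adj
    by (intro filter_hull_least) auto
  have "is_filter (reverse_at s G) ?H'"
    by (rule is_filter_filter_hull[OF wf_digraph_reverse_at[OF wf] verts(2)])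
  then have "is_filter G (insert s ?H')"
    using sink by (auto simp: is_filter_reverse_at is_filter_iff[OF wf] sink_iff)
  then have "?H \<subseteq> insert s ?H'"
    using subset_filter_hull[of F "reverse_at s G"]
      adjacent_in_filter_hull[of _ F "reverse_at s G"]
    by (intro filter_hull_least) auto
  then show "?H - {s} \<subseteq> ?H'" by auto
qed

lemma principal_filter_reverse_at_other:
  assumes "x \<in> verts G" "x \<noteq> s"
  shows "principal_filter (reverse_at s G) x = principal_filter G x - {s}"
proof
  let ?P = "principal_filter G x" and ?P' = "principal_filter (reverse_at s G) x"
  have "is_filter (reverse_at s G) (?P - {s})"
    using is_filter_principal_filter[OF wf, of x]
    by (auto simp: is_filter_reverse_at is_filter_iff[OF wf])
  then show "?P' \<subseteq> ?P - {s}"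
    using in_principal_filter[OF wf assms(1)] assms(2) by (intro principal_filter_least) auto
  have "is_filter G (insert s ?P')"
    using is_filter_principal_filter[OF wf_digraph_reverse_at[OF wf, of s], of x] sink
    by (auto simp: is_filter_reverse_at is_filter_iff[OF wf] sink_iff)
  moreover have "x \<in> ?P'"
    using in_principal_filter[OF wf_digraph_reverse_at[OF wf, of s]] assms(1) by simp
  ultimately have "?P \<subseteq> insert s ?P'" by (intro principal_filter_least) auto
  then show "?P - {s} \<subseteq> ?P'" by auto
qed

lemma principal_filter_sink: "principal_filter G s = {s}"
proof
  show "principal_filter G s \<subseteq> {s}"
    using sink by (intro principal_filter_least) (auto simp: is_filter_iff[OF wf] sink_iff)
qed (use sink in \<open>auto simp: in_principal_filter[OF wf] sink_iff\<close>)

text \<open>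
  All neighbours of \<open>s\<close> are reached from \<open>s\<close> after the reversal, and from there on the old arrows
  are followed.
\<close>

lemma principal_filter_reverse_at_same: "principal_filter (reverse_at s G) s = filter_hull G {s}"
proof
  let ?H = "filter_hull G {s}" and ?P' = "principal_filter (reverse_at s G) s"
  have s: "s \<in> verts G" using sink by (simp add: sink_iff)
  have "is_filter G ?H" using s by (intro is_filter_filter_hull wf) simp
  moreover have "tail G e \<in> ?H" if "e \<in> arcs G" "head G e = s" for e
    using adjacent_in_filter_hull[of s "{s}" G "tail G e"] that by (auto simp: adjacent_def)
  ultimately have "is_filter (reverse_at s G) ?H"
    by (auto simp: is_filter_reverse_at is_filter_iff[OF wf])
  then show "?P' \<subseteq> ?H"
    using subset_filter_hull[of "{s}" G] by (intro principal_filter_least) auto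
  have filter': "is_filter (reverse_at s G) ?P'"
    by (rule is_filter_principal_filter[OF wf_digraph_reverse_at[OF wf]])
  moreover have s': "s \<in> ?P'"
    using in_principal_filter[OF wf_digraph_reverse_at[OF wf, of s]] s by simp
  ultimately show "?H \<subseteq> ?P'"
    using sink
    by (intro filter_hull_least)
      (auto simp: is_filter_reverse_at is_filter_iff[OF wf] adjacent_def sink_iff)
qed

end

section \<open>Principal sequences in terms of levels\<close>

definition principal_levels :: "('v, 'e) pre_digraph \<Rightarrow> nat \<Rightarrow> 'v \<Rightarrow> 'v list \<Rightarrow> bool" where
  "principal_levels G r x S \<longleftrightarrow>
     0 < r \<and> level S r = {} \<and> level S (r - 1) = principal_filter G x \<and>
     (\<forall>i. Suc i < r \<longrightarrow> level S i = filter_hull G (level S (Suc i)))"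

lemma principal_levels_length:
  assumes "wf_digraph G" "x \<in> verts G" "principal_levels G r x S" "canonical_form G S Ss"
  shows "length Ss = r"
  using assms canonical_form_length[OF assms(4)] in_principal_filter[OF assms(1,2)]
  by (auto simp: principal_levels_def)

lemma is_principal_seq_levels:
  assumes "r \<ge> 1" "is_principal_seq G r x R"
  shows "principal_levels G r x R"
proof -
  obtain Rs where Rs: "canonical_form G R Rs" "length Rs = r" "set (last Rs) = principal_filter G x"
    using assms(2) by (auto simp: is_principal_seq_def)
  obtain Ss where Ss: "canonical_form G R Ss"
    "\<forall>i. Suc i < length Ss \<longrightarrow> set (Ss ! i) = filter_hull G (set (Ss ! Suc i))"
    using assms(2) by (auto simp: is_principal_seq_def principal_sequence_def)
  have "length Ss = r"
    using canonical_form_length_iff[OF Rs(1)] canonical_form_length_iff[OF Ss(1)] Rs(2)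
    by (metis linorder_neqE_nat order_less_irrefl)
  then show ?thesis
    using assms(1) Rs Ss(2) canonical_form_last[OF Rs(1)] canonical_form_nth[OF Ss(1)]
      canonical_form_length_iff[OF Rs(1), of r]
    by (auto simp: principal_levels_def)
qed

lemma principal_levels_principal_sequence:
  assumes "wf_digraph G" "x \<in> verts G" "admissible G S" "principal_levels G r x S"
  shows "principal_sequence G S"
proof -
  have "S \<noteq> []"
    using assms in_principal_filter[OF assms(1,2)] by (auto simp: principal_levels_def level_def)
  then obtain Ss where Ss: "canonical_form G S Ss"
    using canonical_form_exists assms(3) by blast
  have "length Ss = r" by (rule principal_levels_length[OF assms(1,2,4) Ss])
  then show ?thesis
    using Ss assms(2,4) canonical_form_nth[OF Ss] canonical_form_last[OF Ss]
    unfolding principal_sequence_def principal_levels_def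
    by (intro exI[of _ Ss]) auto
qed

lemma is_filter_level:
  assumes "wf_digraph G" "admissible G S"
  shows "is_filter G (level S i)"
proof -
  have "level S i \<subseteq> verts G"
    using level_antimono[of 0 i S] admissible_subset_verts[OF assms(2)] by (auto simp: level_0)
  then show ?thesis
    using admissible_count_arc(1)[OF assms(2)]
    by (auto simp: is_filter_iff[OF assms(1)] level_def intro: less_le_trans)
qed

section \<open>Deleting the first term of a principal sequence\<close>

lemma level_tl:
  "level T i =
    (if Suc i = count_list (s # T) s then level (s # T) i - {s} else level (s # T) i)"
  by (auto simp: level_def)

lemma principal_levels_tl:
  assumes wf: "wf_digraph G" and x: "x \<in> verts G" and adm: "admissible G (s # T)"
    and pl: "principal_levels G r x (s # T)" and "T \<noteq> []"
  shows "principal_levels (reverse_at s G) (if s = x then r - 1 else r) x T"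
proof -
  let ?S = "s # T" and ?G' = "reverse_at s G"
  let ?m = "count_list ?S s"
  have sink: "sink G s" using adm by simp
  have r: "0 < r" and top: "level ?S r = {}"
    and lowest: "level ?S (r - 1) = principal_filter G x"
    and hull: "\<And>i. Suc i < r \<Longrightarrow> level ?S i = filter_hull G (level ?S (Suc i))"
    using pl by (auto simp: principal_levels_def)
  have flt: "is_filter G (level ?S i)" for i by (rule is_filter_level[OF wf adm])
  have m_le: "?m \<le> r" using top by (metis (mono_tags, lifting) empty_iff level_def mem_Collect_eq not_le)
  have mem: "s \<in> level ?S i \<longleftrightarrow> i < ?m" for i by (simp add: level_def)
  have level_minus: "level T i = level ?S i - {s}" if "?m \<le> Suc i" for i
    using that mem[of i] by (simp only: level_tl[of T i s]) auto
  have hull_inside: "level T i = filter_hull ?G' (level T (Suc i))"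
    if "Suc i < r" "Suc i < ?m" "s \<in> filter_hull ?G' (level T (Suc i))" for i
  proof -
    have "level T i = level ?S i"
      using that(2) by (simp only: level_tl[of T i s]) simp
    also have "\<dots> = filter_hull ?G' (level T (Suc i))"
      unfolding hull[OF that(1)]
      using flt[of "Suc i"] that(2,3) mem[of "Suc i"]
      by (intro filter_hull_reverse_at_containing[OF wf sink, symmetric])
        (auto simp: is_filter_def level_tl[of T "Suc i" s])
    finally show ?thesis .
  qed
  have hull_outside: "level T i = filter_hull ?G' (level T (Suc i))"
    if "Suc i < r" "?m \<le> Suc i" for i
  proof -
    have notin: "s \<notin> level ?S (Suc i)" using mem[of "Suc i"] that(2) by simp
    have "level T (Suc i) = level ?S (Suc i)"
      using level_minus[of "Suc i"] that(2) notin by simp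
    then show ?thesis
      using level_minus[OF that(2)] hull[OF that(1)]
        filter_hull_reverse_at_avoiding[OF wf sink flt[of "Suc i"] notin] by simp
  qed
  have hull_kept: "level T i = filter_hull ?G' (level T (Suc i))"
    if "Suc i < r" "Suc (Suc i) < ?m" for i
  proof (rule hull_inside)
    have "s \<in> level T (Suc i)"
      using that(2) by (simp add: level_def)
    then show "s \<in> filter_hull ?G' (level T (Suc i))"
      using subset_filter_hull by fast
  qed (use that in auto)
  show ?thesis
  proof (cases "s = x")
    case True
    have low: "level ?S (r - 1) = {s}" using lowest principal_filter_sink[OF wf sink] True by simp
    then have m: "?m = r" using mem[of "r - 1"] m_le r by auto
    have "r \<noteq> 1"
    proof
      assume "r = 1"
      then have "set ?S = {s}" "count_list T s = 0" using low m level_0[of ?S] by auto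
      then show False using \<open>T \<noteq> []\<close> by (cases T) (auto split: if_splits)
    qed
    then obtain q where q: "r = Suc (Suc q)" using r by (metis One_nat_def gr0_implies_Suc not0_implies_Suc)
    have "level T q = filter_hull G {s}"
      using hull[of q] low q m by (simp only: level_tl[of T q s]) simp
    then have "level T q = principal_filter ?G' x"
      using principal_filter_reverse_at_same[OF wf sink] True by simp
    moreover have "level T (Suc q) = {}"
      using level_minus[of "Suc q"] low m q by simp
    moreover have "level T i = filter_hull ?G' (level T (Suc i))" if "Suc i < Suc q" for i
      using that m q by (intro hull_kept) auto
    ultimately show ?thesis using True q by (simp add: principal_levels_def)
  next
    case False
    have "level T (r - 1) = principal_filter ?G' x"
      using level_minus[of "r - 1"] m_le r lowest principal_filter_reverse_at_other[OF wf sink x] False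
      by simp
    moreover have "level T r = {}"
      using level_minus[of r] top m_le by simp
    moreover have "level T i = filter_hull ?G' (level T (Suc i))" if "Suc i < r" for i
    proof -
      consider "?m \<le> Suc i" | "Suc (Suc i) = ?m" | "Suc (Suc i) < ?m" by linarith
      then show ?thesis
      proof cases
        case 2
        \<comment> \<open>\<open>s\<close> is deleted from level \<open>Suc i\<close>, but a neighbour of it there brings it back
           into the hull.\<close>
        have in_lev: "s \<in> level ?S (Suc i)" "s \<notin> level ?S (Suc (Suc i))" using 2 mem by simp_all
        have "\<exists>e \<in> arcs G. head G e = s \<and> tail G e \<in> level ?S (Suc i)"
        proof (cases "Suc (Suc i) = r")
          case True
          then show ?thesis
            using in_principal_filter_arc[OF wf x, of s] in_lev(1) lowest False by force
        next
          case False
          then show ?thesis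
            using sink_in_filter_hull_arc[OF wf sink flt[of "Suc (Suc i)"]] in_lev hull[of "Suc i"] that
            by simp
        qed
        then obtain e where e: "e \<in> arcs G" "head G e = s" "tail G e \<in> level ?S (Suc i)" by blast
        have "tail G e \<in> level T (Suc i)"
          using e sink level_minus[of "Suc i"] 2 by (simp add: sink_iff)
        then have "s \<in> filter_hull ?G' (level T (Suc i))"
          using e by (intro adjacent_in_filter_hull[of "tail G e"]) (auto simp: adjacent_def)
        then show ?thesis using 2 that by (intro hull_inside) simp_all
      qed (use that hull_outside hull_kept in auto)
    qed
    ultimately show ?thesis using False r by (simp add: principal_levels_def)
  qed
qed

theorem proposition3p6:
  fixes G :: "('v, 'e) pre_digraph" and r :: nat and x x1 :: 'v and R S T :: "'v list"
  assumes "acyclic_quiver G"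
    and "r \<ge> 1" and "x \<in> verts G"
    and "is_principal_seq G r x R"
    and "seq_equiv G R S"
    and "S = x1 # T" and "length S > 1"
  shows "admissible (reverse_at x1 G) T \<and> principal_sequence (reverse_at x1 G) T \<and>
    (\<forall>Ss Ts. canonical_form G S Ss \<and> canonical_form (reverse_at x1 G) T Ts \<longrightarrow>
       length Ss = r \<and>
       set (last Ts) = principal_filter (reverse_at x1 G) x \<and>
       (x1 = x \<longrightarrow>
          length Ts = r - 1 \<and>
          (\<forall>i. 0 < i \<and> i < r \<longrightarrow> set (Ts ! (i - 1)) = set (Ss ! (i - 1)))) \<and>
       (x1 \<noteq> x \<longrightarrow>
          length Ts = r \<and>
          (\<forall>i \<in> {1..r}. i \<noteq> count_list S x1 \<longrightarrow> set (Ts ! (i - 1)) = set (Ss ! (i - 1))) \<and>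
          (\<forall>i \<in> {1..r}. i = count_list S x1 \<longrightarrow>
             set (Ts ! (i - 1)) = set (Ss ! (i - 1)) - {x1})))"
proof -
  let ?G' = "reverse_at x1 G" and ?q = "if x1 = x then r - 1 else r"
  interpret acyclic_quiver G by fact
  have wf: "wf_digraph G" by unfold_locales
  note wf' = wf_digraph_reverse_at[OF wf, of x1]
  have x: "x \<in> verts G" and x': "x \<in> verts ?G'" using assms(3) by auto
  have adm: "admissible G (x1 # T)" using assms(5,6) by (simp add: seq_equiv_def)
  then have adm': "admissible ?G' T" by simp
  have pl: "principal_levels G r x (x1 # T)"
    using is_principal_seq_levels[OF assms(2,4)] seq_equiv_level[OF assms(5)] assms(6)
    by (simp add: principal_levels_def)
  have "T \<noteq> []" using assms(6,7) by auto
  note pl' = principal_levels_tl[OF wf x adm pl this]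
  have "length Ss = r \<and>
       set (last Ts) = principal_filter ?G' x \<and>
       (x1 = x \<longrightarrow>
          length Ts = r - 1 \<and>
          (\<forall>i. 0 < i \<and> i < r \<longrightarrow> set (Ts ! (i - 1)) = set (Ss ! (i - 1)))) \<and>
       (x1 \<noteq> x \<longrightarrow>
          length Ts = r \<and>
          (\<forall>i \<in> {1..r}. i \<noteq> count_list S x1 \<longrightarrow> set (Ts ! (i - 1)) = set (Ss ! (i - 1))) \<and>
          (\<forall>i \<in> {1..r}. i = count_list S x1 \<longrightarrow>
             set (Ts ! (i - 1)) = set (Ss ! (i - 1)) - {x1}))"
    if "canonical_form G S Ss" and cT: "canonical_form ?G' T Ts" for Ss Ts
  proof -
    have cS: "canonical_form G (x1 # T) Ss" using that(1) assms(6) by simp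
    have lenS: "length Ss = r" by (rule principal_levels_length[OF wf x pl cS])
    have lenT: "length Ts = ?q" by (rule principal_levels_length[OF wf' x' pl' cT])
    have last: "set (last Ts) = principal_filter ?G' x"
      using canonical_form_last[OF cT] lenT pl' by (simp add: principal_levels_def)
    have supp: "set (Ts ! (i - 1)) =
        (if i = count_list S x1 then set (Ss ! (i - 1)) - {x1} else set (Ss ! (i - 1)))"
      if "1 \<le> i" "i \<le> ?q" for i
      using that canonical_form_nth[OF cS, of "i - 1"] canonical_form_nth[OF cT, of "i - 1"]
        lenS lenT level_tl[of T "i - 1" x1] assms(6) by (auto split: if_splits)
    \<comment> \<open>If \<open>x1 = x\<close>, then the lowest level contains \<open>x1\<close>, so \<open>x1\<close> has multiplicity at least \<open>r\<close>.\<close>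
    have "r \<le> count_list S x1" if "x1 = x"
    proof -
      have "x1 \<in> level (x1 # T) (r - 1)"
        using that pl in_principal_filter[OF wf x] by (simp add: principal_levels_def)
      then show ?thesis using assms(6) by (simp add: level_def)
    qed
    then show ?thesis using lenS lenT last supp by auto
  qed
  then show ?thesis
    by (intro conjI[OF adm' conjI[OF principal_levels_principal_sequence[OF wf' x' adm' pl']]]
        allI impI) (elim conjE)
qed

end
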